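(* Let $\mathcal{L}=(V,E)$, $E=E_2\cup E_3$, be a finite hypergraph whose edges are links (elements of $E_2$, unordered pairs of distinct sites) and triangles (elements of $E_3$, unordered triples of distinct sites), such that each site has exactly three incident edges, any pair of distinct edges share at most one site, and all triangles are pairwise disjoint. Let $\{K_e\}_{e\in E}$ be edge operators on $\mathcal{L}$ chosen so that $K_{u,v,w}=Z_uZ_vZ_w$ for all triangles $(u,v,w)\in E_3$. Let $\mathcal{G}_{loop}$ be the group of loop operators of $\mathcal{L}$, and let $\mathcal{G}$ be the group generated by the solid and dashed link operators $K'_e$, $e\in E'$. Then, up to overall phase factors, $$\mathcal{G}_{loop}=\mathcal{C}(\mathcal{G}).$$
   Context: Each site $u\in V$ carries one qubit; $X_u,Y_u,Z_u$ are the Pauli operators on it, and $\mathcal{P}$ is the Pauli group on the qubits in $V$ (including the phases $\pm1,\pm i$). $\mathcal{C}(\mathcal{G})$ is the centralizer of $\mathcal{G}$ in $\mathcal{P}$. Groups of Pauli operators are compared ignoring overall phase factors (i.e. after adjoining $iI$). Edge operators: a family of hermitian Pauli operators $K_e$, $e\in E$, where $K_e$ acts on the qubits of $e$ only (a two-qubit operator for a link, a three-qubit operator for a triangle), satisfying for all $e,e'\in E$ $$K_eK_{e'}=(-1)^{\eta(e,e')}K_{e'}K_e,$$ where $\eta(e,e')=1$ if $e$ and $e'$ share exactly one site and $\eta(e,e')=0$ otherwise. Cycles and loop operators: a subset $M\subseteq E$ is a cycle iff every site has an even number of incident edges from $M$. The loop operator of a cycle $M$ is $W(M)=\prod_{e\in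 M}K_e$ (defined up to a phase depending on the order of the factors). $\mathcal{G}_{loop}$ is the group generated by the $W(M)$ over all cycles $M\subseteq E$. Link operators $K'_e$: let $\mathcal{L}'=(V,E')$ be the graph with $E'=E_s\cup E_d$, where $E_s=E_2$ is the set of solid links and $E_d$, the set of dashed links, consists of the three links $(u,v),(v,w),(u,w)$ for every triangle $(u,v,w)\in E_3$. Set $K'_{u,v}=K_{u,v}$ if $(u,v)$ is a solid link and $K'_{u,v}=Z_uZ_v$ if $(u,v)$ is a dashed link. *)

theory Defs
  imports "HOL-Analysis.Cartesian_Space" "HOL-Algebra.Generated_Groups"
begin

section \<open>Pauli operators\<close>

text \<open>The sites are the elements of a finite type. A computational basis state of the qubits
  is a function from sites to truth values (\<open>False\<close> is the state 0, \<open>True\<close> is the state 1), and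
  operators are matrices indexed by basis states.\<close>

type_synonym qubit_op = "complex ^ bool ^ bool"
type_synonym 'v operator = "complex ^ ('v \<Rightarrow> bool) ^ ('v \<Rightarrow> bool)"

definition sigma_x :: qubit_op where
  "sigma_x = (\<chi> a b. if a = b then 0 else 1)"

definition sigma_y :: qubit_op where
  "sigma_y = (\<chi> a b. if a = b then 0 else if b then - \<i> else \<i>)"

definition sigma_z :: qubit_op where
  "sigma_z = (\<chi> a b. if a \<noteq> b then 0 else if a then - 1 else 1)"

definition qubit_paulis :: "qubit_op set" where
  "qubit_paulis = {mat 1, sigma_x, sigma_y, sigma_z}"

definition tensor :: "('v::finite \<Rightarrow> qubit_op) \<Rightarrow> 'v operator" where
  "tensor p = (\<chi> s t. \<Prod>u\<in>UNIV. p u $ s u $ t u)"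

definition pauli_Z :: "'v::finite \<Rightarrow> 'v operator" where
  "pauli_Z u = tensor ((\<lambda>_. mat 1)(u := sigma_z))"

definition phases :: "complex set" where
  "phases = {1, - 1, \<i>, - \<i>}"

definition pauli_ops_on :: "'v::finite set \<Rightarrow> 'v operator set" where
  "pauli_ops_on S = {mat c ** tensor p | c p.
     c \<in> phases \<and> (\<forall>u. p u \<in> qubit_paulis) \<and> (\<forall>u. u \<notin> S \<longrightarrow> p u = mat 1)}"

definition pauli_group :: "'v::finite operator monoid" where
  "pauli_group = \<lparr>carrier = pauli_ops_on UNIV, monoid.mult = (**), one = mat 1\<rparr>"

definition hermitian :: "complex ^ 'n ^ 'n \<Rightarrow> bool" where
  "hermitian A \<longleftrightarrow> (\<forall>i j. A $ i $ j = cnj (A $ j $ i))"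

definition centralizer :: "('a, 'b) monoid_scheme \<Rightarrow> 'a set \<Rightarrow> 'a set" where
  "centralizer G H = {x \<in> carrier G. \<forall>y\<in>H. x \<otimes>\<^bsub>G\<^esub> y = y \<otimes>\<^bsub>G\<^esub> x}"

text \<open>Note that \<open>mat \<i>\<close> is the scalar operator \<open>\<i> I\<close>.\<close>

definition eq_upto_phase :: "'v::finite operator set \<Rightarrow> 'v operator set \<Rightarrow> bool" where
  "eq_upto_phase A B \<longleftrightarrow>
     generate pauli_group (insert (mat \<i>) A) = generate pauli_group (insert (mat \<i>) B)"


section \<open>Edge, loop and link operators\<close>

text \<open>An edge (link or triangle) is the set of its sites.\<close>

definition edge_operators :: "'v::finite set set \<Rightarrow> ('v set \<Rightarrow> 'v operator) \<Rightarrow> bool" where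
  "edge_operators E K \<longleftrightarrow>
     (\<forall>e\<in>E. K e \<in> pauli_ops_on e \<and> hermitian (K e)) \<and>
     (\<forall>e\<in>E. \<forall>e'\<in>E. K e ** K e' =
        mat ((- 1) ^ (if card (e \<inter> e') = 1 then 1 else 0)) ** (K e' ** K e))"

definition is_cycle :: "'v set set \<Rightarrow> 'v set set \<Rightarrow> bool" where
  "is_cycle E M \<longleftrightarrow> M \<subseteq> E \<and> (\<forall>u. even (card {e \<in> M. u \<in> e}))"

text \<open>\<open>is_loop_operator K M A\<close>: the operator \<open>A\<close> is the product of the \<open>K e\<close>, \<open>e \<in> M\<close>, each
  occurring once, taken in some order.\<close>

definition is_loop_operator ::
    "('v::finite set \<Rightarrow> 'v operator) \<Rightarrow> 'v set set \<Rightarrow> 'v operator \<Rightarrow> bool" where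
  "is_loop_operator K M A \<longleftrightarrow>
     (\<exists>es. distinct es \<and> set es = M \<and> A = foldr (\<lambda>e B. K e ** B) es (mat 1))"

definition dashed_links :: "'v set set \<Rightarrow> 'v set set" where
  "dashed_links E3 = {{u, v} | u v. u \<noteq> v \<and> (\<exists>T\<in>E3. u \<in> T \<and> v \<in> T)}"

definition link_operator ::
    "'v set set \<Rightarrow> ('v set \<Rightarrow> 'v operator) \<Rightarrow> 'v::finite \<Rightarrow> 'v \<Rightarrow> 'v operator" where
  "link_operator E2 K u v = (if {u, v} \<in> E2 then K {u, v} else pauli_Z u ** pauli_Z v)"

definition link_group ::
    "'v::finite set set \<Rightarrow> 'v set set \<Rightarrow> ('v set \<Rightarrow> 'v operator) \<Rightarrow> 'v operator set" where
  "link_group E2 E3 K = generate pauli_group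
     {link_operator E2 K u v | u v. {u, v} \<in> E2 \<union> dashed_links E3}"

end

theory Submission
  imports Defs
begin

text \<open>At every site \<open>u\<close> the three incident edge operators anticommute pairwise, so their factors at
  \<open>u\<close> are the three Pauli matrices in some order. Both a solid link operator and \<open>Z\<^sub>u Z\<^sub>v\<close> on a
  dashed link are, up to a phase, the product of the factors at \<open>u\<close> and \<open>v\<close> of the edge \<open>e\<close>
  containing \<open>u\<close> and \<open>v\<close>. Hence a Pauli operator \<open>P\<close> centralizes the link group iff the sign with
  which \<open>P\<close> commutes with the factor of \<open>e\<close> at \<open>u \<in> e\<close> depends on \<open>e\<close> only. The edges with sign
  \<open>- 1\<close> then form a cycle \<open>M\<close>, because a Pauli matrix anticommutes with none or with two of
  the three. As \<open>W M\<close> has the same signs, \<open>P ** W M\<close> commutes with all the factors and is a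
  phase.\<close>

section \<open>Scalar matrices and commutation up to a scalar\<close>

lemma mat_mult_nth [simp]:
  fixes A :: "'a::semiring_1 ^ 'n::finite ^ 'n"
  shows "(mat c ** A) $ i $ j = c * A $ i $ j"
  by (simp add: matrix_matrix_mult_def mat_def if_distrib[of "\<lambda>x. x * _"] cong: if_cong)

lemma mult_mat_nth [simp]:
  fixes A :: "'a::comm_semiring_1 ^ 'n::finite ^ 'n"
  shows "(A ** mat c) $ i $ j = c * A $ i $ j"
  by (simp add: matrix_matrix_mult_def mat_def if_distrib[of "\<lambda>x. _ * x"] mult.commute cong: if_cong)

lemma mult_mat_commute:
  fixes A :: "'a::comm_semiring_1 ^ 'n::finite ^ 'n"
  shows "A ** mat c = mat c ** A"
  by (simp add: vec_eq_iff)

lemma mat_mult_mat: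
  "mat c ** mat d = (mat (c * d) :: 'a::semiring_1 ^ 'n::finite ^ 'n)"
  by (simp add: vec_eq_iff) (simp add: mat_def)

lemma mat_mult_mat_mult:
  fixes A :: "'a::semiring_1 ^ 'n::finite ^ 'n"
  shows "mat c ** (mat d ** A) = mat (c * d) ** A"
  by (simp add: matrix_mul_assoc mat_mult_mat)

lemma mult_mat_left_commute:
  fixes A B :: "'a::comm_semiring_1 ^ 'n::finite ^ 'n"
  shows "A ** (mat c ** B) = mat c ** (A ** B)"
  by (metis matrix_mul_assoc mult_mat_commute)

text \<open>A right inverse strips \<open>A\<close> from both sides; a diagonal entry of the two
  remaining scalar matrices then gives the scalars.\<close>

lemma mat_mult_cancel:
  fixes A :: "'a::field ^ 'n::finite ^ 'n"
  assumes "mat c ** A = mat d ** A" "A ** B = mat 1"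
  shows "c = d"
proof -
  have "mat c ** (A ** B) = mat d ** (A ** B)"
    using assms(1) by (simp add: matrix_mul_assoc)
  then have "mat c = (mat d :: 'a ^ 'n ^ 'n)"
    by (simp add: assms(2))
  then have "mat c $ i $ i = (mat d :: 'a ^ 'n ^ 'n) $ i $ i" for i
    by simp
  then show ?thesis by (simp add: mat_def)
qed

text \<open>For Pauli operators the scalar is a sign, the multiplicative form of the symplectic
  product over the field of two elements. Being multiplicative in both arguments, it reduces
  commutation questions to single sites.\<close>

definition q_commute :: "complex \<Rightarrow> complex ^ 'n ^ 'n \<Rightarrow> complex ^ 'n ^ 'n::finite \<Rightarrow> bool" where
  "q_commute c A B \<longleftrightarrow> A ** B = mat c ** (B ** A)"

lemma q_commute_1_iff: "q_commute 1 A B \<longleftrightarrow> A ** B = B ** A"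
  by (simp add: q_commute_def)

lemma q_commute_mult_left:
  assumes "q_commute c A B" "q_commute d A' B"
  shows "q_commute (c * d) (A ** A') B"
proof -
  have "A ** A' ** B = mat d ** (A ** B ** A')"
    using assms(2) by (simp add: q_commute_def mult_mat_left_commute[of A] flip: matrix_mul_assoc)
  also have "\<dots> = mat (c * d) ** (B ** (A ** A'))"
    using assms(1)
    by (simp add: q_commute_def mat_mult_mat_mult mult.commute flip: matrix_mul_assoc)
  finally show ?thesis by (simp add: q_commute_def)
qed

lemma q_commute_mult_right:
  assumes "q_commute c A B" "q_commute d A B'"
  shows "q_commute (c * d) A (B ** B')"
proof -
  have "A ** (B ** B') = mat c ** (B ** (A ** B'))"
    using assms(1) by (simp add: q_commute_def matrix_mul_assoc)
  also have "\<dots> = mat (c * d) ** (B ** B' ** A)"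
    using assms(2)
    by (simp add: q_commute_def mat_mult_mat_mult mult_mat_left_commute[of B] flip: matrix_mul_assoc)
  finally show ?thesis by (simp add: q_commute_def)
qed

lemma q_commute_mat_left: "q_commute 1 (mat c) A"
  by (simp add: q_commute_def mult_mat_commute)

lemma q_commute_mat_right: "q_commute 1 A (mat c)"
  by (simp add: q_commute_def mult_mat_commute)

text \<open>Scalars can be collected in any order, so the order of the factors is lost and the
  product ranges over a set; \<open>distinct\<close> makes every factor count once.\<close>

lemma q_commute_foldr:
  assumes "distinct es" "\<And>e. e \<in> set es \<Longrightarrow> q_commute (c e) (K e) B"
  shows "q_commute (\<Prod>e\<in>set es. c e) (foldr (\<lambda>e A. K e ** A) es (mat 1)) B"
  using assms
  by (induction es) (simp_all add: q_commute_mat_left q_commute_mult_left)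


section \<open>Single-qubit Pauli operators\<close>

lemma qubit_mult_nth:
  "((A :: qubit_op) ** B) $ a $ b =
    A $ a $ True * B $ True $ b + A $ a $ False * B $ False $ b"
  by (simp add: matrix_matrix_mult_def UNIV_bool add.commute)

lemmas sigma_defs = sigma_x_def sigma_y_def sigma_z_def mat_def

lemma qubit_paulis_distinct [simp]:
  "sigma_x \<noteq> mat 1" "sigma_y \<noteq> mat 1" "sigma_z \<noteq> mat 1"
  "sigma_x \<noteq> sigma_y" "sigma_x \<noteq> sigma_z" "sigma_y \<noteq> sigma_z"
  "mat 1 \<noteq> sigma_x" "mat 1 \<noteq> sigma_y" "mat 1 \<noteq> sigma_z"
  "sigma_y \<noteq> sigma_x" "sigma_z \<noteq> sigma_x" "sigma_z \<noteq> sigma_y"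
  by (simp_all add: vec_eq_iff all_bool_eq sigma_defs complex_eq_iff)

lemma qubit_paulis_mult_table:
  "sigma_x ** sigma_x = mat 1" "sigma_y ** sigma_y = mat 1" "sigma_z ** sigma_z = mat 1"
  "sigma_x ** sigma_y = mat \<i> ** sigma_z" "sigma_y ** sigma_x = mat (- \<i>) ** sigma_z"
  "sigma_y ** sigma_z = mat \<i> ** sigma_x" "sigma_z ** sigma_y = mat (- \<i>) ** sigma_x"
  "sigma_z ** sigma_x = mat \<i> ** sigma_y" "sigma_x ** sigma_z = mat (- \<i>) ** sigma_y"
  by (simp_all add: vec_eq_iff all_bool_eq qubit_mult_nth del: mat_mult_nth mult_mat_nth)
     (simp_all add: sigma_defs)

text \<open>The commutation sign of two single-qubit Pauli matrices, as
  \<open>qubit_paulis_q_commute\<close> confirms; the formula is meant for arguments in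
  \<open>qubit_paulis\<close>.\<close>

definition qubit_sign :: "qubit_op \<Rightarrow> qubit_op \<Rightarrow> complex" where
  "qubit_sign a b = (if a = mat 1 \<or> b = mat 1 \<or> a = b then 1 else - 1)"

lemma qubit_sign_simps [simp]:
  "qubit_sign (mat 1) a = 1" "qubit_sign a (mat 1) = 1" "qubit_sign a a = 1"
  by (simp_all add: qubit_sign_def)

lemma qubit_sign_cases: "qubit_sign a b = 1 \<or> qubit_sign a b = - 1"
  by (simp add: qubit_sign_def)

lemma qubit_paulis_square: "a \<in> qubit_paulis \<Longrightarrow> a ** a = mat 1"
  by (auto simp: qubit_paulis_def qubit_paulis_mult_table)

lemma qubit_paulis_mult:
  assumes "a \<in> qubit_paulis" "b \<in> qubit_paulis"
  shows "\<exists>c\<in>phases. \<exists>d\<in>qubit_paulis. a ** b = mat c ** d"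
  using assms unfolding qubit_paulis_def
  by (elim insertE emptyE; simp add: qubit_paulis_mult_table)
     (force simp: phases_def intro: exI[of _ "mat 1"] bexI[of _ 1])+

lemma qubit_paulis_q_commute:
  assumes "a \<in> qubit_paulis" "b \<in> qubit_paulis"
  shows "a ** b = mat (qubit_sign a b) ** (b ** a)"
  using assms unfolding qubit_paulis_def
  by (elim insertE emptyE; simp add: qubit_paulis_mult_table mat_mult_mat_mult qubit_sign_def)

text \<open>A Pauli matrix other than the identity anticommutes with all three except itself. This
  parity later turns the set of edges with sign \<open>- 1\<close> into a cycle.\<close>

lemma even_card_anticommuting:
  assumes "a \<in> qubit_paulis"
  shows "even (card {b \<in> {sigma_x, sigma_y, sigma_z}. qubit_sign a b = - 1})"
proof -
  have eq: "{b \<in> {sigma_x, sigma_y, sigma_z}. qubit_sign a b = - 1} =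
      (if a = mat 1 then {} else {sigma_x, sigma_y, sigma_z} - {a})"
    by (auto simp: qubit_sign_def)
  have "a = mat 1 \<or> a \<in> {sigma_x, sigma_y, sigma_z}"
    using assms by (auto simp: qubit_paulis_def)
  then show ?thesis
    unfolding eq by (auto simp: card_Diff_singleton)
qed


section \<open>Pauli strings and the Pauli group\<close>

lemma tensor_mult:
  fixes p q :: "'v::finite \<Rightarrow> qubit_op"
  shows "tensor p ** tensor q = tensor (\<lambda>u. p u ** q u)"
proof -
  have "(tensor p ** tensor q) $ s $ t = tensor (\<lambda>u. p u ** q u) $ s $ t" for s t
  proof -
    have "(tensor p ** tensor q) $ s $ t =
        (\<Sum>r\<in>UNIV. \<Prod>u\<in>UNIV. p u $ s u $ r u * q u $ r u $ t u)"
      by (simp add: tensor_def matrix_matrix_mult_def prod.distrib)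
    \<comment> \<open>Distributivity: an intermediate basis state \<open>r\<close> is an independent
      choice of one bit \<open>b\<close> per site.\<close>
    also have "\<dots> = (\<Prod>u\<in>UNIV. \<Sum>b\<in>UNIV. p u $ s u $ b * q u $ b $ t u)"
      by (subst prod_sum_PiE) (simp_all add: PiE_UNIV_domain)
    finally show ?thesis
      by (simp add: tensor_def matrix_matrix_mult_def)
  qed
  then show ?thesis by (simp add: vec_eq_iff)
qed

lemma tensor_scale: "tensor (\<lambda>u. mat (c u) ** p u) = mat (\<Prod>u\<in>UNIV. c u) ** tensor p"
  by (simp add: vec_eq_iff) (simp add: tensor_def prod.distrib)

lemma tensor_one [simp]: "tensor (\<lambda>_. mat 1) = mat 1"
proof -
  \<comment> \<open>Distinct basis states differ at some site, and the factor 0 there kills the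
    product.\<close>
  have "(\<Prod>u\<in>UNIV. (mat 1 :: qubit_op) $ s u $ t u) = mat 1 $ s $ t" for s t :: "'a \<Rightarrow> bool"
    by (cases "s = t") (auto simp: mat_def fun_eq_iff)
  then show ?thesis by (simp add: vec_eq_iff) (simp add: tensor_def)
qed

definition pauli_string :: "('v \<Rightarrow> qubit_op) \<Rightarrow> bool" where
  "pauli_string p \<longleftrightarrow> (\<forall>u. p u \<in> qubit_paulis)"

lemma phases_one [simp]: "1 \<in> phases"
  by (simp add: phases_def)

lemma phases_mult: "c \<in> phases \<Longrightarrow> d \<in> phases \<Longrightarrow> c * d \<in> phases"
  by (auto simp: phases_def)

lemma phases_inverse: "c \<in> phases \<Longrightarrow> inverse c \<in> phases"
  by (auto simp: phases_def)

lemma phases_nonzero: "c \<in> phases \<Longrightarrow> c \<noteq> 0"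
  by (auto simp: phases_def)

lemma phases_prod: "(\<And>u. u \<in> A \<Longrightarrow> c u \<in> phases) \<Longrightarrow> prod c A \<in> phases"
  by (induction A rule: infinite_finite_induct) (auto intro: phases_mult)

lemma mat_1_in_qubit_paulis [simp]: "mat 1 \<in> qubit_paulis"
  and sigma_z_in_qubit_paulis [simp]: "sigma_z \<in> qubit_paulis"
  by (simp_all add: qubit_paulis_def)

lemma pauli_string_mult:
  assumes "pauli_string p" "pauli_string q"
  obtains c r where "c \<in> phases" "pauli_string r" "tensor p ** tensor q = mat c ** tensor r"
proof -
  have "\<forall>u. \<exists>c d. c \<in> phases \<and> d \<in> qubit_paulis \<and> p u ** q u = mat c ** d"
    using assms qubit_paulis_mult unfolding pauli_string_def by meson
  then obtain c r where cr: "\<And>u. c u \<in> phases" "\<And>u. r u \<in> qubit_paulis"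
      "\<And>u. p u ** q u = mat (c u) ** r u"
    by metis
  have "tensor p ** tensor q = mat (prod c UNIV) ** tensor r"
    by (simp add: tensor_mult cr tensor_scale)
  then show thesis
    using cr by (intro that[of "prod c UNIV" r]) (auto simp: pauli_string_def intro: phases_prod)
qed

lemma pauli_string_square: "pauli_string p \<Longrightarrow> tensor p ** tensor p = mat 1"
  by (simp add: tensor_mult pauli_string_def qubit_paulis_square)

text \<open>The sites are exchanged independently, each at the cost of its own sign, and
  \<open>tensor_scale\<close> collects the signs.\<close>

lemma pauli_string_q_commute:
  assumes "pauli_string p" "pauli_string q"
  shows "q_commute (\<Prod>u\<in>UNIV. qubit_sign (p u) (q u)) (tensor p) (tensor q)"
proof -
  have "tensor p ** tensor q = tensor (\<lambda>u. mat (qubit_sign (p u) (q u)) ** (q u ** p u))"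
    using assms
    by (auto simp: tensor_mult pauli_string_def intro!: arg_cong[of _ _ tensor] qubit_paulis_q_commute)
  then show ?thesis
    by (simp add: q_commute_def tensor_scale tensor_mult)
qed

lemma pauli_q_commute:
  assumes "pauli_string p" "pauli_string q"
  shows "q_commute (\<Prod>u\<in>UNIV. qubit_sign (p u) (q u)) (mat c ** tensor p) (mat d ** tensor q)"
  using q_commute_mult_left[OF q_commute_mat_left
      q_commute_mult_right[OF q_commute_mat_right pauli_string_q_commute[OF assms]]]
  by simp

lemma carrier_pauli_group: "carrier pauli_group = {mat c ** tensor p | c p. c \<in> phases \<and> pauli_string p}"
  by (auto simp: pauli_group_def pauli_ops_on_def pauli_string_def)

lemma mult_pauli_group [simp]: "A \<otimes>\<^bsub>pauli_group\<^esub> B = A ** B"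
  and one_pauli_group [simp]: "\<one>\<^bsub>pauli_group\<^esub> = mat 1"
  by (simp_all add: pauli_group_def)

lemma pauli_groupI [intro]:
  "c \<in> phases \<Longrightarrow> pauli_string p \<Longrightarrow> mat c ** tensor p \<in> carrier pauli_group"
  by (auto simp: carrier_pauli_group)

lemma pauli_groupE:
  assumes "A \<in> carrier pauli_group"
  obtains c p where "c \<in> phases" "pauli_string p" "A = mat c ** tensor p"
  using assms by (auto simp: carrier_pauli_group)

lemma tensor_in_pauli_group: "pauli_string p \<Longrightarrow> tensor p \<in> carrier pauli_group"
  using pauli_groupI[of 1 p] by simp

lemma mat_in_pauli_group: "c \<in> phases \<Longrightarrow> mat c \<in> carrier pauli_group"
  using pauli_groupI[of c "\<lambda>_. mat 1"] by (simp add: pauli_string_def)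

lemma pauli_group_mult_closed:
  assumes "A \<in> carrier pauli_group" "B \<in> carrier pauli_group"
  shows "A ** B \<in> carrier pauli_group"
proof -
  obtain c p where A: "c \<in> phases" "pauli_string p" "A = mat c ** tensor p"
    using assms(1) by (rule pauli_groupE)
  obtain d q where B: "d \<in> phases" "pauli_string q" "B = mat d ** tensor q"
    using assms(2) by (rule pauli_groupE)
  obtain e r where C: "e \<in> phases" "pauli_string r" "tensor p ** tensor q = mat e ** tensor r"
    using A B pauli_string_mult by blast
  have "A ** B = mat c ** (mat d ** (tensor p ** tensor q))"
    by (simp add: A B mult_mat_left_commute[of "tensor p"] flip: matrix_mul_assoc)
  also have "\<dots> = mat (c * (d * e)) ** tensor r"
    by (simp add: C mat_mult_mat_mult mult.assoc)
  finally have "A ** B = mat (c * (d * e)) ** tensor r" .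
  then show ?thesis using A B C by (auto intro!: phases_mult)
qed

lemma pauli_group_left_inverse:
  assumes "A \<in> carrier pauli_group"
  shows "\<exists>B\<in>carrier pauli_group. B ** A = mat 1"
proof -
  obtain c p where A: "c \<in> phases" "pauli_string p" "A = mat c ** tensor p"
    using assms by (rule pauli_groupE)
  \<comment> \<open>A Pauli string is its own inverse, so only the phase has to be inverted.\<close>
  have "mat (inverse c) ** tensor p ** A = mat 1"
    using phases_nonzero[OF A(1)]
    by (simp add: A mult_mat_left_commute[of "tensor p"] mat_mult_mat_mult mat_mult_mat pauli_string_square
        flip: matrix_mul_assoc)
  then show ?thesis using A phases_inverse by blast
qed

lemma group_pauli_group: "group pauli_group"
  by (rule groupI)
     (auto simp: pauli_group_mult_closed mat_in_pauli_group pauli_group_left_inverse matrix_mul_assoc)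

interpretation pauli: group pauli_group
  by (rule group_pauli_group)

text \<open>Holds because \<open>B ** A\<close> is invertible. It is used to compare a sign computed
  site by site with one known by assumption.\<close>

lemma q_commute_unique:
  assumes "A \<in> carrier pauli_group" "B \<in> carrier pauli_group" "q_commute c A B" "q_commute d A B"
  shows "c = d"
proof -
  have "B ** A \<in> carrier pauli_group"
    using assms pauli_group_mult_closed by blast
  then obtain C where "B ** A ** C = mat 1"
    using pauli.r_inv_ex by auto
  then show ?thesis
    using assms(3,4) mat_mult_cancel unfolding q_commute_def by metis
qed

lemma foldr_mult_in_pauli_group:
  assumes "\<And>e. e \<in> set es \<Longrightarrow> K e \<in> carrier pauli_group"
  shows "foldr (\<lambda>e A. K e ** A) es (mat 1) \<in> carrier pauli_group"
  using assms by (induction es) (simp_all add: pauli_group_mult_closed mat_in_pauli_group)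

text \<open>Serves as a probe: its commutation sign with a Pauli string depends on the entry of the
  string at \<open>u\<close> alone.\<close>

definition site_op :: "'v::finite \<Rightarrow> qubit_op \<Rightarrow> 'v operator" where
  "site_op u a = tensor ((\<lambda>_. mat 1)(u := a))"

lemma pauli_string_site: "a \<in> qubit_paulis \<Longrightarrow> pauli_string ((\<lambda>_. mat 1)(u := a))"
  by (simp add: pauli_string_def)

lemma site_op_in_pauli_group: "a \<in> qubit_paulis \<Longrightarrow> site_op u a \<in> carrier pauli_group"
  by (simp add: site_op_def tensor_in_pauli_group pauli_string_site)

lemma q_commute_site_op:
  assumes "pauli_string p" "a \<in> qubit_paulis"
  shows "q_commute (qubit_sign (p u) a) (mat c ** tensor p) (site_op u a)"
proof -
  \<comment> \<open>At all other sites the second string is the identity and contributes 1.\<close>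
  have "(\<Prod>v\<in>UNIV. qubit_sign (p v) (((\<lambda>_. mat 1)(u := a)) v)) = (\<Prod>v\<in>{u}. qubit_sign (p v) a)"
    by (rule prod.mono_neutral_cong_right) auto
  then show ?thesis
    using pauli_q_commute[OF assms(1) pauli_string_site[OF assms(2)], of u c 1]
    by (simp add: site_op_def)
qed

text \<open>Splits the operator of a solid link into its factors at the two ends.\<close>

lemma site_op_mult:
  assumes "u \<noteq> v" "\<And>w. w \<notin> {u, v} \<Longrightarrow> p w = mat 1"
  shows "site_op u (p u) ** site_op v (p v) = tensor p"
proof -
  have "(\<lambda>w. ((\<lambda>_. mat 1)(u := p u)) w ** ((\<lambda>_. mat 1)(v := p v)) w) = p"
  proof
    fix w
    show "((\<lambda>_. mat 1)(u := p u)) w ** ((\<lambda>_. mat 1)(v := p v)) w = p w"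
      using assms(1) assms(2)[of w] by (cases "w = u"; cases "w = v") simp_all
  qed
  then show ?thesis by (simp add: site_op_def tensor_mult)
qed


section \<open>Centralizers\<close>

lemma (in group) subgroup_centralizer:
  assumes "H \<subseteq> carrier G"
  shows "subgroup (centralizer G H) G"
proof (rule subgroupI)
  show "centralizer G H \<noteq> {}"
  proof -
    have "\<one> \<in> centralizer G H"
      using assms by (auto simp: centralizer_def)
    then show ?thesis by blast
  qed
next
  fix a assume a: "a \<in> centralizer G H"
  have "inv a \<otimes> y = y \<otimes> inv a" if "y \<in> H" for y
  proof -
    have y: "y \<in> carrier G" "a \<in> carrier G" "a \<otimes> y = y \<otimes> a"
      using a that assms by (auto simp: centralizer_def)
    have "inv a \<otimes> y = inv a \<otimes> (y \<otimes> a) \<otimes> inv a"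
      using y(1,2) by (simp add: m_assoc)
    also have "\<dots> = inv a \<otimes> (a \<otimes> y) \<otimes> inv a"
      using y(3) by simp
    also have "\<dots> = y \<otimes> inv a"
      using y(1,2) by (simp flip: m_assoc)
    finally show ?thesis .
  qed
  then show "inv a \<in> centralizer G H" using a by (simp add: centralizer_def)
next
  fix a b assume a: "a \<in> centralizer G H" and b: "b \<in> centralizer G H"
  have "a \<otimes> b \<otimes> y = y \<otimes> (a \<otimes> b)" if "y \<in> H" for y
  proof -
    have y: "y \<in> carrier G" "a \<in> carrier G" "a \<otimes> y = y \<otimes> a" "b \<in> carrier G" "b \<otimes> y = y \<otimes> b"
      using a b that assms by (auto simp: centralizer_def)
    then show ?thesis by (metis m_assoc)
  qed
  then show "a \<otimes> b \<in> centralizer G H" using a b by (simp add: centralizer_def)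
qed (auto simp: centralizer_def)

text \<open>Commuting is symmetric: if \<open>x\<close> centralizes \<open>H\<close>, then
  \<open>H\<close> lies in the centralizer of \<open>{x}\<close>, which is a subgroup and so
  contains everything that \<open>H\<close> generates.\<close>

lemma (in group) centralizer_generate:
  assumes "H \<subseteq> carrier G"
  shows "centralizer G (generate G H) = centralizer G H"
proof
  show "centralizer G (generate G H) \<subseteq> centralizer G H"
    by (auto simp: centralizer_def intro: generate.incl)
  show "centralizer G H \<subseteq> centralizer G (generate G H)"
  proof
    fix x assume x: "x \<in> centralizer G H"
    then have "H \<subseteq> centralizer G {x}" "x \<in> carrier G"
      using assms by (auto simp: centralizer_def)
    then have "generate G H \<subseteq> centralizer G {x}"
      by (intro generate_subgroup_incl subgroup_centralizer) auto
    then show "x \<in> centralizer G (generate G H)"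
      using \<open>x \<in> carrier G\<close> by (auto simp: centralizer_def)
  qed
qed


section \<open>Trivalent families of Pauli strings\<close>

text \<open>\<open>k e\<close> is the string of single-qubit factors of the edge operator of \<open>e\<close>.\<close>

locale trivalent_paulis =
  fixes E :: "'v::finite set set" and k :: "'v set \<Rightarrow> 'v \<Rightarrow> qubit_op"
  assumes trivalent: "card {e \<in> E. u \<in> e} = 3"
    and string: "e \<in> E \<Longrightarrow> pauli_string (k e)"
    and sign: "e \<in> E \<Longrightarrow> f \<in> E \<Longrightarrow> u \<in> e \<Longrightarrow>
      qubit_sign (k f u) (k e u) = (if u \<in> f \<and> f \<noteq> e then - 1 else 1)"
begin

lemma factor_in_qubit_paulis: "e \<in> E \<Longrightarrow> k e u \<in> qubit_paulis"
  using string by (simp add: pauli_string_def)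

text \<open>Factors of distinct edges at \<open>u\<close> anticommute, so they differ, and none is
  the identity since each has another one to anticommute with. Three distinct nonidentity Pauli
  matrices are all of them.\<close>

lemma factors_bij: "bij_betw (\<lambda>e. k e u) {e \<in> E. u \<in> e} {sigma_x, sigma_y, sigma_z}"
proof -
  have inj: "inj_on (\<lambda>e. k e u) {e \<in> E. u \<in> e}"
  proof (rule inj_onI)
    fix e f assume ef: "e \<in> {e \<in> E. u \<in> e}" "f \<in> {e \<in> E. u \<in> e}" and eq: "k e u = k f u"
    show "e = f"
    proof (rule ccontr)
      assume "e \<noteq> f"
      then have "qubit_sign (k f u) (k e u) = - 1" using ef sign by simp
      then show False by (simp add: eq)
    qed
  qed
  have "k e u \<in> {sigma_x, sigma_y, sigma_z}" if e: "e \<in> E" "u \<in> e" for e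
  proof -
    \<comment> \<open>Trivalence provides a second edge \<open>f\<close> at \<open>u\<close>, whose
      factor anticommutes with that of \<open>e\<close>.\<close>
    have "\<not> {e \<in> E. u \<in> e} \<subseteq> {e}"
    proof
      assume "{e \<in> E. u \<in> e} \<subseteq> {e}"
      then have "card {e \<in> E. u \<in> e} \<le> card {e}" by (rule card_mono[rotated]) simp
      then show False by (simp add: trivalent)
    qed
    then obtain f where "f \<in> E" "u \<in> f" "f \<noteq> e" by blast
    then have "qubit_sign (k f u) (k e u) = - 1" using e sign by simp
    then have "k e u \<noteq> mat 1" by auto
    then show ?thesis using factor_in_qubit_paulis[OF e(1), of u] by (simp add: qubit_paulis_def)
  qed
  then have "(\<lambda>e. k e u) ` {e \<in> E. u \<in> e} \<subseteq> {sigma_x, sigma_y, sigma_z}" by blast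
  moreover have "card ((\<lambda>e. k e u) ` {e \<in> E. u \<in> e}) = card {sigma_x, sigma_y, sigma_z}"
    by (simp add: card_image[OF inj] trivalent)
  ultimately show ?thesis
    using inj by (simp add: bij_betw_def card_subset_eq)
qed

lemma eq_mat_1_if_commutes:
  assumes "\<And>e. e \<in> E \<Longrightarrow> u \<in> e \<Longrightarrow> qubit_sign a (k e u) = 1"
  shows "a = mat 1"
proof -
  have "qubit_sign a b = 1" if "b \<in> {sigma_x, sigma_y, sigma_z}" for b
    using that assms unfolding bij_betw_imp_surj_on[OF factors_bij[of u], symmetric] by blast
  \<comment> \<open>Two of the three suffice: an \<open>a\<close> other than the identity would have
    to equal both.\<close>
  then have "qubit_sign a sigma_x = 1" "qubit_sign a sigma_y = 1" by simp_all
  then show ?thesis by (auto simp: qubit_sign_def split: if_splits)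
qed

text \<open>Transports \<open>even_card_anticommuting\<close> from Pauli matrices to the edges at
  \<open>u\<close> along \<open>factors_bij\<close>.\<close>

lemma even_card_anticommuting_edges:
  assumes "a \<in> qubit_paulis"
  shows "even (card {e \<in> E. u \<in> e \<and> qubit_sign a (k e u) = - 1})"
proof -
  let ?S = "{e \<in> E. u \<in> e \<and> qubit_sign a (k e u) = - 1}"
  have "inj_on (\<lambda>e. k e u) ?S"
    by (rule inj_on_subset[OF bij_betw_imp_inj_on[OF factors_bij]]) auto
  then have "card ?S = card ((\<lambda>e. k e u) ` ?S)"
    by (simp add: card_image)
  also have "(\<lambda>e. k e u) ` ?S = {b \<in> (\<lambda>e. k e u) ` {e \<in> E. u \<in> e}. qubit_sign a b = - 1}"
    by auto
  also have "\<dots> = {b \<in> {sigma_x, sigma_y, sigma_z}. qubit_sign a b = - 1}"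
    unfolding bij_betw_imp_surj_on[OF factors_bij] ..
  finally show ?thesis using even_card_anticommuting[OF assms] by simp
qed

text \<open>At each site the string of \<open>P\<close> commutes with the factors of all incident
  edges, so \<open>eq_mat_1_if_commutes\<close> makes it trivial there and only the phase is
  left.\<close>

lemma scalar_if_commutes:
  assumes P: "P \<in> carrier pauli_group"
    and comm: "\<And>e u. e \<in> E \<Longrightarrow> u \<in> e \<Longrightarrow> q_commute 1 P (site_op u (k e u))"
  obtains c where "c \<in> phases" "P = mat c"
proof -
  obtain c p where p: "c \<in> phases" "pauli_string p" "P = mat c ** tensor p"
    using P by (rule pauli_groupE)
  have "p u = mat 1" for u
  proof (rule eq_mat_1_if_commutes)
    fix e assume e: "e \<in> E" "u \<in> e"
    show "qubit_sign (p u) (k e u) = 1"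
    proof (rule q_commute_unique[OF P site_op_in_pauli_group])
      show "k e u \<in> qubit_paulis" using e factor_in_qubit_paulis by simp
      then show "q_commute (qubit_sign (p u) (k e u)) P (site_op u (k e u))"
        using p q_commute_site_op by simp
    qed (rule comm[OF e])
  qed
  then have "p = (\<lambda>_. mat 1)" by auto
  then show thesis using p that by simp
qed

text \<open>Only the edges of \<open>M\<close> at \<open>u\<close> other than \<open>e\<close>
  contribute \<open>- 1\<close>. Since \<open>M\<close> has an even number of edges at
  \<open>u\<close>, leaving out \<open>e\<close> makes their number odd exactly when
  \<open>e\<close> belongs to \<open>M\<close>.\<close>

lemma cycle_product_q_commute:
  assumes M: "is_cycle E M" and es: "distinct es" "set es = M"
    and K: "\<And>f. f \<in> M \<Longrightarrow> K f = mat (c f) ** tensor (k f)"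
    and e: "e \<in> E" "u \<in> e"
  shows "q_commute (if e \<in> M then - 1 else 1) (foldr (\<lambda>f A. K f ** A) es (mat 1)) (site_op u (k e u))"
proof -
  let ?N = "{f \<in> M. u \<in> f \<and> f \<noteq> e}"
  have sub: "M \<subseteq> E" and even: "even (card {f \<in> M. u \<in> f})"
    using M by (auto simp: is_cycle_def)
  have "q_commute (\<Prod>f\<in>set es. if u \<in> f \<and> f \<noteq> e then - 1 else 1)
      (foldr (\<lambda>f A. K f ** A) es (mat 1)) (site_op u (k e u))"
  proof (rule q_commute_foldr[OF es(1)])
    fix f assume "f \<in> set es"
    then have f: "f \<in> M" "f \<in> E" using es sub by auto
    show "q_commute (if u \<in> f \<and> f \<noteq> e then - 1 else 1) (K f) (site_op u (k e u))"
      using q_commute_site_op[OF string[OF f(2)] factor_in_qubit_paulis[OF e(1), of u], of u "c f"]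
      by (simp add: K[OF f(1)] sign[OF e(1) f(2) e(2)])
  qed
  moreover have "(\<Prod>f\<in>set es. if u \<in> f \<and> f \<noteq> e then - 1 else (1::complex)) = (\<Prod>f\<in>?N. - 1)"
    unfolding es(2) by (rule prod.mono_neutral_cong_right) auto
  moreover have "card {f \<in> M. u \<in> f} = (if e \<in> M then Suc (card ?N) else card ?N)"
  proof (cases "e \<in> M")
    case True
    then have "{f \<in> M. u \<in> f} = insert e ?N" using e by auto
    then show ?thesis using True by simp
  next
    case False
    then have "{f \<in> M. u \<in> f} = ?N" by auto
    then show ?thesis using False by simp
  qed
  ultimately show ?thesis
    using even by (auto split: if_splits)
qed

lemma obtain_cycle:
  assumes P: "P \<in> carrier pauli_group"
    and comm: "\<And>e u v. e \<in> E \<Longrightarrow> u \<in> e \<Longrightarrow> v \<in> e \<Longrightarrow> u \<noteq> v \<Longrightarrow>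
      P ** (site_op u (k e u) ** site_op v (k e v)) = site_op u (k e u) ** site_op v (k e v) ** P"
  obtains M where "is_cycle E M"
    "\<And>e u. e \<in> E \<Longrightarrow> u \<in> e \<Longrightarrow> q_commute (if e \<in> M then - 1 else 1) P (site_op u (k e u))"
proof -
  obtain c p where p: "c \<in> phases" "pauli_string p" "P = mat c ** tensor p"
    using P by (rule pauli_groupE)
  have q: "q_commute (qubit_sign (p u) (k e u)) P (site_op u (k e u))" if "e \<in> E" for e u
    unfolding p(3) by (rule q_commute_site_op[OF p(2) factor_in_qubit_paulis[OF that]])
  have agree: "qubit_sign (p u) (k e u) = qubit_sign (p v) (k e v)"
    if e: "e \<in> E" "u \<in> e" "v \<in> e" for e u v
  proof (cases "u = v")
    case False
    \<comment> \<open>\<open>P\<close> commutes with the product of the two factors, so their signs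
      multiply to 1; being 1 or \<open>- 1\<close>, they coincide.\<close>
    have "qubit_sign (p u) (k e u) * qubit_sign (p v) (k e v) = 1"
    proof (rule q_commute_unique[OF P])
      show "site_op u (k e u) ** site_op v (k e v) \<in> carrier pauli_group"
        using e(1) by (intro pauli_group_mult_closed site_op_in_pauli_group factor_in_qubit_paulis)
      show "q_commute (qubit_sign (p u) (k e u) * qubit_sign (p v) (k e v)) P
          (site_op u (k e u) ** site_op v (k e v))"
        by (rule q_commute_mult_right[OF q[OF e(1)] q[OF e(1)]])
      show "q_commute 1 P (site_op u (k e u) ** site_op v (k e v))"
        using comm[OF e False] by (simp add: q_commute_1_iff)
    qed
    then show ?thesis
      using qubit_sign_cases[of "p u" "k e u"] qubit_sign_cases[of "p v" "k e v"] by auto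
  qed simp
  \<comment> \<open>By \<open>agree\<close>, the site witnessing membership is immaterial: any site
    of \<open>e\<close> decides whether \<open>e\<close> is in \<open>M\<close>.\<close>
  define M where "M = {e \<in> E. \<exists>u\<in>e. qubit_sign (p u) (k e u) = - 1}"
  have M: "e \<in> M \<longleftrightarrow> qubit_sign (p u) (k e u) = - 1" if e: "e \<in> E" "u \<in> e" for e u
  proof
    assume "e \<in> M"
    then obtain v where "v \<in> e" "qubit_sign (p v) (k e v) = - 1"
      unfolding M_def by blast
    then show "qubit_sign (p u) (k e u) = - 1"
      using agree[OF e] by simp
  qed (use e M_def in blast)
  have "{e \<in> M. u \<in> e} = {e \<in> E. u \<in> e \<and> qubit_sign (p u) (k e u) = - 1}" for u
    using M M_def by blast
  then have "is_cycle E M"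
    using even_card_anticommuting_edges p(2) by (auto simp: is_cycle_def M_def pauli_string_def)
  moreover have "q_commute (if e \<in> M then - 1 else 1) P (site_op u (k e u))"
    if e: "e \<in> E" "u \<in> e" for e u
    using q[OF e(1), of u] qubit_sign_cases[of "p u" "k e u"] M[OF e] by auto
  ultimately show thesis by (rule that)
qed

end


section \<open>Loop operators and the link group\<close>

text \<open>Allows the phase of a link operator to be dropped when testing whether \<open>P\<close>
  commutes with it.\<close>

lemma commute_mat_mult_iff:
  fixes A P :: "'a::field ^ 'n::finite ^ 'n"
  assumes "c \<noteq> 0"
  shows "P ** (mat c ** A) = mat c ** A ** P \<longleftrightarrow> P ** A = A ** P"
proof -
  have "P ** (mat c ** A) = mat c ** (P ** A)" by (rule mult_mat_left_commute)
  moreover have "mat c ** A ** P = mat c ** (A ** P)" by (simp add: matrix_mul_assoc)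
  ultimately show ?thesis using assms by (simp add: vec_eq_iff)
qed

lemma pauli_Z_eq_site_op: "pauli_Z u = site_op u sigma_z"
  by (simp add: pauli_Z_def site_op_def)

lemma triangle_operator:
  assumes "u \<noteq> v" "u \<noteq> w" "v \<noteq> w"
  shows "pauli_Z u ** pauli_Z v ** pauli_Z w = tensor (\<lambda>x. if x \<in> {u, v, w} then sigma_z else mat 1)"
proof -
  have "((\<lambda>_. mat 1)(u := sigma_z)) x ** ((\<lambda>_. mat 1)(v := sigma_z)) x ** ((\<lambda>_. mat 1)(w := sigma_z)) x
      = (if x \<in> {u, v, w} then sigma_z else mat 1)" for x
    using assms by simp
  then show ?thesis by (simp add: pauli_Z_def tensor_mult)
qed

text \<open>The powers of \<open>\<i>\<close> are all four phases.\<close>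

lemma mat_in_generate:
  assumes "c \<in> phases" "mat \<i> \<in> H"
  shows "mat c \<in> generate pauli_group H"
proof -
  have mult: "mat (c * d) \<in> generate pauli_group H"
    if "mat c \<in> generate pauli_group H" "mat d \<in> generate pauli_group H" for c d
    using generate.eng[OF that] by (simp add: mat_mult_mat)
  have 1: "mat 1 \<in> generate pauli_group H"
    using generate.one[of pauli_group H] by simp
  have i: "mat \<i> \<in> generate pauli_group H"
    using assms(2) by (rule generate.incl)
  have m: "mat (- 1) \<in> generate pauli_group H"
    using mult[OF i i] by simp
  show ?thesis
    using assms(1) 1 i m mult[OF m i] by (auto simp: phases_def)
qed

theorem lemma3p3:
  fixes E2 E3 :: "'v::finite set set"
    and K :: "'v set \<Rightarrow> 'v operator"
    and W :: "'v set set \<Rightarrow> 'v operator"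
  assumes links: "\<And>e. e \<in> E2 \<Longrightarrow> card e = 2"
    and triangles: "\<And>e. e \<in> E3 \<Longrightarrow> card e = 3"
    and trivalent: "\<And>u. card {e \<in> E2 \<union> E3. u \<in> e} = 3"
    and share: "\<And>e e'. e \<in> E2 \<union> E3 \<Longrightarrow> e' \<in> E2 \<union> E3 \<Longrightarrow> e \<noteq> e' \<Longrightarrow> card (e \<inter> e') \<le> 1"
    and disjoint_triangles: "\<And>T T'. T \<in> E3 \<Longrightarrow> T' \<in> E3 \<Longrightarrow> T \<noteq> T' \<Longrightarrow> T \<inter> T' = {}"
    and edge_ops: "edge_operators (E2 \<union> E3) K"
    and K_triangle: "\<And>u v w. {u, v, w} \<in> E3 \<Longrightarrow> K {u, v, w} = pauli_Z u ** pauli_Z v ** pauli_Z w"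
    and loop_ops: "\<And>M. is_cycle (E2 \<union> E3) M \<Longrightarrow> is_loop_operator K M (W M)"
  shows "eq_upto_phase
           (generate pauli_group (W ` {M. is_cycle (E2 \<union> E3) M}))
           (centralizer pauli_group (link_group E2 E3 K))"
proof -

  \<comment> \<open>Pauli strings of the edge operators\<close>
  let ?E = "E2 \<union> E3"
  \<comment> \<open>Collects all demands on phase and string so that both can be chosen at once. The
    \<open>sigma_z\<close> clause belongs to the choice because strings are not shown to be
    determined by their operators.\<close>
  define R where "R e c p \<longleftrightarrow> pauli_string p \<and> c \<in> phases \<and> (\<forall>u. u \<notin> e \<longrightarrow> p u = mat 1) \<and>
      K e = mat c ** tensor p \<and> (e \<in> E3 \<longrightarrow> (\<forall>u\<in>e. p u = sigma_z))" for e c p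
  have "\<exists>c p. R e c p" if e: "e \<in> ?E" for e
  proof (cases "e \<in> E3")
    case True
    then obtain u v w where uvw: "e = {u, v, w}" "u \<noteq> v" "u \<noteq> w" "v \<noteq> w"
      using triangles[OF True] by (auto simp: card_3_iff)
    have "K e = mat 1 ** tensor (\<lambda>x. if x \<in> e then sigma_z else mat 1)"
      using K_triangle[of u v w] True triangle_operator[OF uvw(2-)] by (simp add: uvw(1))
    then show ?thesis
      by (intro exI[of _ 1] exI[of _ "\<lambda>x. if x \<in> e then sigma_z else mat 1"])
         (simp add: R_def pauli_string_def)
  next
    case False
    have "K e \<in> pauli_ops_on e"
      using edge_ops e by (simp add: edge_operators_def)
    then show ?thesis
      using False by (auto simp: R_def pauli_ops_on_def pauli_string_def)
  qed
  then obtain c k where "\<And>e. e \<in> ?E \<Longrightarrow> R e (c e) (k e)"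
    by metis
  then have k: "\<And>e. e \<in> ?E \<Longrightarrow> pauli_string (k e)"
    and c: "\<And>e. e \<in> ?E \<Longrightarrow> c e \<in> phases"
    and supp: "\<And>e u. e \<in> ?E \<Longrightarrow> u \<notin> e \<Longrightarrow> k e u = mat 1"
    and K: "\<And>e. e \<in> ?E \<Longrightarrow> K e = mat (c e) ** tensor (k e)"
    and kZ: "\<And>e u. e \<in> E3 \<Longrightarrow> u \<in> e \<Longrightarrow> k e u = sigma_z"
    by (auto simp: R_def)

  \<comment> \<open>The strings form a trivalent family\<close>
  interpret trivalent_paulis ?E k
  proof
    fix u show "card {e \<in> ?E. u \<in> e} = 3" by (rule trivalent)
  next
    fix e assume "e \<in> ?E" then show "pauli_string (k e)" by (rule k)
  next
    fix e f u assume e: "e \<in> ?E" "u \<in> e" and f: "f \<in> ?E"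
    show "qubit_sign (k f u) (k e u) = (if u \<in> f \<and> f \<noteq> e then - 1 else 1)"
    proof (cases "u \<in> f \<and> f \<noteq> e")
      \<comment> \<open>Distinct edges through \<open>u\<close> meet only there, so the sign between
        \<open>K f\<close> and \<open>K e\<close> is the one at \<open>u\<close>; the axiom on edge
        operators says that it is \<open>- 1\<close>.\<close>
      case True
      then have "card (f \<inter> e) \<le> 1" "u \<in> f \<inter> e"
        using share[OF f e(1)] e(2) by auto
      then have fe: "f \<inter> e = {u}"
        using card_le_Suc0_iff_eq[of "f \<inter> e"] by auto
      have "(\<Prod>v\<in>UNIV. qubit_sign (k f v) (k e v)) = (\<Prod>v\<in>{u}. qubit_sign (k f v) (k e v))"
      proof (rule prod.mono_neutral_right)
        have "k f v = mat 1 \<or> k e v = mat 1" if "v \<noteq> u" for v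
          using fe that supp e(1) f by blast
        then show "\<forall>v\<in>UNIV - {u}. qubit_sign (k f v) (k e v) = 1"
          by (auto simp: qubit_sign_def)
      qed auto
      then have 1: "q_commute (qubit_sign (k f u) (k e u)) (K f) (K e)"
        using pauli_q_commute[OF k[OF f] k[OF e(1)]] by (simp add: K[OF f] K[OF e(1)])
      have "K f ** K e = mat ((- 1) ^ (if card (f \<inter> e) = 1 then 1 else 0)) ** (K e ** K f)"
        using edge_ops e(1) f unfolding edge_operators_def by blast
      then have 2: "q_commute (- 1) (K f) (K e)"
        by (simp add: fe q_commute_def)
      have "K f \<in> carrier pauli_group" "K e \<in> carrier pauli_group"
        using K k c e(1) f by auto
      then show ?thesis using q_commute_unique 1 2 True by simp
    \<comment> \<open>Otherwise \<open>k f u\<close> is the identity or equal to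
      \<open>k e u\<close>.\<close>
    qed (use supp[OF f] in auto)
  qed

  \<comment> \<open>Link operators as products of two site factors\<close>
  let ?L = "\<lambda>e u. site_op u (k e u)"
  have link: "\<exists>d\<in>phases. link_operator E2 K u v = mat d ** (?L e u ** ?L e v)"
    if e: "e \<in> ?E" "u \<in> e" "v \<in> e" "u \<noteq> v" for e u v
  proof (cases "e \<in> E2")
    case True
    then have "e = {u, v}"
      using links[OF True] e by (auto simp: card_2_iff)
    then show ?thesis
      using True site_op_mult[OF e(4), of "k e"] supp[OF e(1)] c[OF e(1)] K[OF e(1)]
      by (auto simp: link_operator_def)
  next
    case False
    then have T: "e \<in> E3" using e by simp
    \<comment> \<open>A solid link inside a triangle would share two sites with it. Hence the
      definition of \<open>link_operator\<close> takes the branch with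
      \<open>pauli_Z\<close>.\<close>
    have "{u, v} \<notin> E2"
    proof
      assume uv: "{u, v} \<in> E2"
      have "{u, v} \<inter> e = {u, v}" using e by auto
      moreover have "{u, v} \<noteq> e" using uv False by blast
      ultimately show False
        using share[of "{u, v}" e] uv e by simp
    qed
    then have "link_operator E2 K u v = mat 1 ** (?L e u ** ?L e v)"
      using e T by (simp add: link_operator_def pauli_Z_eq_site_op kZ)
    then show ?thesis using phases_one by blast
  qed
  \<comment> \<open>Trades links for edges with two chosen sites, the form in which
    \<open>link\<close> is stated.\<close>
  have adjacent: "{u, v} \<in> E2 \<union> dashed_links E3 \<longleftrightarrow> u \<noteq> v \<and> (\<exists>e\<in>?E. u \<in> e \<and> v \<in> e)" for u v
  proof
    assume "{u, v} \<in> E2 \<union> dashed_links E3"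
    then show "u \<noteq> v \<and> (\<exists>e\<in>?E. u \<in> e \<and> v \<in> e)"
    proof
      assume "{u, v} \<in> E2"
      moreover from links[OF this] have "u \<noteq> v" by auto
      ultimately show ?thesis by blast
    next
      assume "{u, v} \<in> dashed_links E3"
      then show ?thesis by (auto simp: dashed_links_def doubleton_eq_iff)
    qed
  next
    assume uv: "u \<noteq> v \<and> (\<exists>e\<in>?E. u \<in> e \<and> v \<in> e)"
    then obtain e where e: "e \<in> ?E" "u \<in> e" "v \<in> e" by blast
    show "{u, v} \<in> E2 \<union> dashed_links E3"
    proof (cases "e \<in> E2")
      case True
      then have "e = {u, v}"
        using links[OF True] e uv by (auto simp: card_2_iff)
      then show ?thesis using True by simp
    next
      case False
      then show ?thesis using e uv by (auto simp: dashed_links_def)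
    qed
  qed

  \<comment> \<open>The centralizer in terms of site factors\<close>
  let ?gens = "{link_operator E2 K u v | u v. {u, v} \<in> E2 \<union> dashed_links E3}"
  let ?C = "centralizer pauli_group (link_group E2 E3 K)"
  have L_carrier: "?L e u ** ?L e v \<in> carrier pauli_group" if "e \<in> ?E" for e u v
    using that by (intro pauli_group_mult_closed site_op_in_pauli_group factor_in_qubit_paulis)
  have gens: "?gens \<subseteq> carrier pauli_group"
  proof
    fix g assume "g \<in> ?gens"
    then obtain u v where g: "g = link_operator E2 K u v" "u \<noteq> v" "\<exists>e\<in>?E. u \<in> e \<and> v \<in> e"
      unfolding adjacent by blast
    then obtain e where e: "e \<in> ?E" "u \<in> e" "v \<in> e" by blast
    obtain d where "d \<in> phases" "g = mat d ** (?L e u ** ?L e v)"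
      using link[OF e g(2)] g(1) by blast
    then show "g \<in> carrier pauli_group"
      using pauli_group_mult_closed[OF mat_in_pauli_group L_carrier[OF e(1)]] by simp
  qed
  have C_sub: "subgroup ?C pauli_group"
    unfolding link_group_def
    by (intro pauli.subgroup_centralizer pauli.generate_incl gens)
  have C_eq: "?C = centralizer pauli_group ?gens"
    unfolding link_group_def by (rule pauli.centralizer_generate[OF gens])
  have commute_link: "P ** link_operator E2 K u v = link_operator E2 K u v ** P \<longleftrightarrow>
      P ** (?L e u ** ?L e v) = ?L e u ** ?L e v ** P"
    if e: "e \<in> ?E" "u \<in> e" "v \<in> e" "u \<noteq> v" for P e u v
  proof -
    obtain d where "d \<in> phases" "link_operator E2 K u v = mat d ** (?L e u ** ?L e v)"
      using link[OF e] by blast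
    then show ?thesis using commute_mat_mult_iff[OF phases_nonzero] by metis
  qed
  \<comment> \<open>Generators suffice by \<open>C_eq\<close> and phases drop out by
    \<open>commute_link\<close>; what remains is the hypothesis of
    \<open>obtain_cycle\<close>.\<close>
  have C_iff: "P \<in> ?C \<longleftrightarrow> P \<in> carrier pauli_group \<and>
      (\<forall>e\<in>?E. \<forall>u\<in>e. \<forall>v\<in>e. u \<noteq> v \<longrightarrow> P ** (?L e u ** ?L e v) = ?L e u ** ?L e v ** P)" for P
  proof -
    have "P \<in> ?C \<longleftrightarrow> P \<in> carrier pauli_group \<and> (\<forall>u v. u \<noteq> v \<and> (\<exists>e\<in>?E. u \<in> e \<and> v \<in> e) \<longrightarrow>
        P ** link_operator E2 K u v = link_operator E2 K u v ** P)"
      unfolding C_eq unfolding centralizer_def adjacent mult_pauli_group by blast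
    also have "\<dots> \<longleftrightarrow> P \<in> carrier pauli_group \<and> (\<forall>e\<in>?E. \<forall>u\<in>e. \<forall>v\<in>e. u \<noteq> v \<longrightarrow>
        P ** link_operator E2 K u v = link_operator E2 K u v ** P)"
      by blast
    also have "\<dots> \<longleftrightarrow> P \<in> carrier pauli_group \<and>
        (\<forall>e\<in>?E. \<forall>u\<in>e. \<forall>v\<in>e. u \<noteq> v \<longrightarrow> P ** (?L e u ** ?L e v) = ?L e u ** ?L e v ** P)"
      by (intro conj_cong ball_cong imp_cong refl commute_link)
    finally show ?thesis .
  qed

  \<comment> \<open>Commutation signs of loop operators\<close>
  have W: "W M \<in> carrier pauli_group"
      "\<And>e u. e \<in> ?E \<Longrightarrow> u \<in> e \<Longrightarrow> q_commute (if e \<in> M then - 1 else 1) (W M) (?L e u)"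
    if M: "is_cycle ?E M" for M
  proof -
    obtain es where es: "distinct es" "set es = M" "W M = foldr (\<lambda>e B. K e ** B) es (mat 1)"
      using loop_ops[OF M] by (auto simp: is_loop_operator_def)
    have sub: "M \<subseteq> ?E" using M by (simp add: is_cycle_def)
    have "K e \<in> carrier pauli_group" if "e \<in> ?E" for e
      unfolding K[OF that] by (rule pauli_groupI[OF c[OF that] k[OF that]])
    then show "W M \<in> carrier pauli_group"
      unfolding es(3) using es(2) sub by (intro foldr_mult_in_pauli_group) blast
    show "q_commute (if e \<in> M then - 1 else 1) (W M) (?L e u)" if "e \<in> ?E" "u \<in> e" for e u
      unfolding es(3) by (rule cycle_product_q_commute[OF M es(1,2) K that]) (use sub in blast)
  qed

  \<comment> \<open>Loop operators centralize the link group\<close>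
  let ?A = "generate pauli_group (W ` {M. is_cycle ?E M})"
  have "W M \<in> ?C" if M: "is_cycle ?E M" for M
    unfolding C_iff
  proof (intro conjI ballI impI W(1)[OF M])
    fix e u v assume e: "e \<in> ?E" "u \<in> e" "v \<in> e"
    \<comment> \<open>Both factors belong to \<open>e\<close> and carry the same sign, whose square
      is 1.\<close>
    have "q_commute 1 (W M) (?L e u ** ?L e v)"
      using q_commute_mult_right[OF W(2)[OF M e(1,2)] W(2)[OF M e(1,3)]] by (auto split: if_splits)
    then show "W M ** (?L e u ** ?L e v) = ?L e u ** ?L e v ** W M"
      by (simp only: q_commute_1_iff)
  qed
  then have A_sub: "?A \<subseteq> ?C"
    by (intro pauli.generate_subgroup_incl C_sub) blast

  \<comment> \<open>Centralizing operators are loop operators up to a phase\<close>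
  let ?S = "generate pauli_group (insert (mat \<i>) ?A)"
  have "insert (mat \<i>) ?A \<subseteq> carrier pauli_group"
    using A_sub subgroup.subset[OF C_sub] by (auto intro!: mat_in_pauli_group simp: phases_def)
  then have S_sub: "subgroup ?S pauli_group"
    by (rule pauli.generate_is_subgroup)
  have "?C \<subseteq> ?S"
  proof
    fix P assume "P \<in> ?C"
    then have P: "P \<in> carrier pauli_group"
      and comm: "\<And>e u v. e \<in> ?E \<Longrightarrow> u \<in> e \<Longrightarrow> v \<in> e \<Longrightarrow> u \<noteq> v \<Longrightarrow>
        P ** (?L e u ** ?L e v) = ?L e u ** ?L e v ** P"
      unfolding C_iff by blast+
    obtain M where M: "is_cycle ?E M"
      "\<And>e u. e \<in> ?E \<Longrightarrow> u \<in> e \<Longrightarrow> q_commute (if e \<in> M then - 1 else 1) P (?L e u)"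
      using obtain_cycle[OF P comm] by blast
    \<comment> \<open>\<open>P\<close> and \<open>W M\<close> have equal signs against every factor,
      and these cancel in the product.\<close>
    have "q_commute 1 (P ** W M) (?L e u)" if "e \<in> ?E" "u \<in> e" for e u
      using q_commute_mult_left[OF M(2)[OF that] W(2)[OF M(1) that]] by (auto split: if_splits)
    then obtain d where d: "d \<in> phases" "P ** W M = mat d"
      using scalar_if_commutes[OF pauli_group_mult_closed[OF P W(1)[OF M(1)]]] by blast
    have "P = mat d \<otimes>\<^bsub>pauli_group\<^esub> inv\<^bsub>pauli_group\<^esub> W M"
      using d P W(1)[OF M(1)] mat_in_pauli_group
      by (metis mult_pauli_group pauli.inv_solve_right)
    moreover have "mat d \<in> ?S"
      using d(1) by (rule mat_in_generate) simp
    moreover have "W M \<in> ?S"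
      using M(1) by (auto intro!: generate.incl)
    ultimately show "P \<in> ?S"
      using subgroup.m_closed[OF S_sub] subgroup.m_inv_closed[OF S_sub] by simp
  qed
  moreover have "mat \<i> \<in> ?S"
    by (auto intro: generate.incl)
  ultimately have "generate pauli_group (insert (mat \<i>) ?C) \<subseteq> ?S"
    by (intro pauli.generate_subgroup_incl S_sub) blast
  moreover have "?S \<subseteq> generate pauli_group (insert (mat \<i>) ?C)"
    using A_sub by (intro pauli.mono_generate) blast
  ultimately show ?thesis
    unfolding eq_upto_phase_def by blast
qed

end
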